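(* Let $n\ge 2$ be an integer and let $a\ge 0$ and $b\ge 0$ be real numbers with $(a,b)\ne(0,0)$. Let $X$ be a real random variable with continuous cumulative distribution function $F$, and let $Q$ be the pseudo-inverse (quantile) function of $F$. Let $X_{n,n}$ be the maximum of a sample of size $n$ with parent $X$. Let $\xi_1$ and $\xi_2$ be independent standard exponential random variables which are also independent from $X$ and $X_{n,n}$, respectively. Then $$X+a\xi_1\stackrel{d}{=}X_{n,n}-b\xi_2$$ holds if and only if there is a constant $c>0$ (which may be arbitrary) such that $$Q(x)=\log\left\{c\,x^{b}(1-x^{n-1})^{-d}\right\}\qquad\text{for all } 0<x<1,$$ where $d=(b+na)/(n-1)$.
   Context: $\stackrel{d}{=}$ denotes equality in distribution. $X_{n,n}$ is the largest order statistic, i.e. the maximum of $n$ independent copies of $X$. A standard exponential variable has cumulative distribution function $1-e^{-t}$ for $t\ge 0$. The pseudo-inverse (quantile) function of $F$ is $Q(y)=\inf\{x:\ F(x)\ge y\}$ for $y\in(0,1)$. $\log$ is the natural logarithm. *)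

theory Defs
  imports "HOL-Probability.Probability"
begin

text \<open>Only meaningful for \<open>0 < y < 1\<close>, where for a distribution function \<open>F\<close> the set is
  nonempty and bounded below; elsewhere the real infimum may be a junk value.\<close>

definition quantile :: "(real \<Rightarrow> real) \<Rightarrow> real \<Rightarrow> real" where
  "quantile F y = Inf {x. F x \<ge> y}"

text \<open>The largest order statistic of the sample \<open>Y 0, \<dots>, Y (n - 1)\<close>, for \<open>n > 0\<close>.\<close>

definition sample_max :: "nat \<Rightarrow> (nat \<Rightarrow> 'a \<Rightarrow> real) \<Rightarrow> 'a \<Rightarrow> real" where
  "sample_max n Y \<omega> = Max ((\<lambda>i. Y i \<omega>) ` {..<n})"

definition iid_copies :: "'a measure \<Rightarrow> nat \<Rightarrow> (nat \<Rightarrow> 'a \<Rightarrow> real) \<Rightarrow> ('a \<Rightarrow> real) \<Rightarrow> bool" where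
  "iid_copies M n Y X \<longleftrightarrow>
     prob_space.indep_vars M (\<lambda>_. borel) Y {..<n} \<and>
     (\<forall>i<n. distr M borel (Y i) = distr M borel X)"

definition std_exponential :: "'a measure \<Rightarrow> ('a \<Rightarrow> real) \<Rightarrow> bool" where
  "std_exponential M \<xi> \<longleftrightarrow> distributed M lborel \<xi> (exponential_density 1)"

end

(* A law Z convolved with a scaled exponential a xi has distribution function E solving the
   linear equation E + a E' = F, for either sign of a.  Hence if X + a xi_1 and X_{n,n} - b xi_2
   share the distribution function H, then H + a H' = F and H - b H' = F^n, so that
   H = (b F + a F^n) / (a + b) and (a + b) H' = F - F^n.  Where 0 < F < 1 this is an autonomous
   differential equation for F, and separating variables gives b ln F - d ln (1 - F^(n-1)) = t - k,
   which says that Q has the stated form.  Conversely, the solution (b F + a F^n) / (a + b) of both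
   linear equations agrees with both convolutions, because it is bounded while solutions of the
   homogeneous equations are multiples of exponentials. *)

theory Submission
  imports Defs
begin

section \<open>Averaging a bounded function against the exponential law\<close>

text \<open>The expectation of \<open>f (t - a * xi)\<close> for a standard exponential
  \<open>xi\<close>. When \<open>f\<close> is the distribution function of a variable
  \<open>Z\<close> independent of \<open>xi\<close>, this is the distribution function of
  \<open>Z + a * xi\<close>. The sign of \<open>a\<close> is left free so that
  \<open>X + a * xi\<close> and a maximum minus \<open>b * xi\<close> are treated alike.\<close>

definition exp_mean :: "real \<Rightarrow> (real \<Rightarrow> real) \<Rightarrow> real \<Rightarrow> real" where
  "exp_mean a f t = (LINT s|lborel. exponential_density 1 s * f (t - a * s))"

lemma has_bochner_integral_exponential_density:
  "has_bochner_integral lborel (exponential_density 1) 1"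
proof -
  interpret prob_space "density lborel (exponential_density 1)"
    by (rule prob_space_exponential_density) simp
  have "(\<integral>\<^sup>+ x. ennreal (exponential_density 1 x) \<partial>lborel) = 1"
    using emeasure_space_1 by (simp add: emeasure_density)
  then show ?thesis
    by (intro has_bochner_integral_nn_integral) (auto simp: exponential_density_nonneg)
qed

lemmas integrable_exponential_density = integrable.intros[OF has_bochner_integral_exponential_density]
  and integral_exponential_density =
    has_bochner_integral_integral_eq[OF has_bochner_integral_exponential_density]

lemma integrable_exp_mean:
  assumes [measurable]: "f \<in> borel_measurable borel" and bnd: "\<And>x. \<bar>f x\<bar> \<le> C"
  shows "integrable lborel (\<lambda>s. exponential_density 1 s * f (t - a * s))"
proof (rule Bochner_Integration.integrable_bound)
  show "integrable lborel (\<lambda>s. exponential_density 1 s * C)"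
    by (intro integrable_mult_left integrable_exponential_density)
  have "C \<ge> 0"
    using bnd[of 0] by linarith
  then show "AE s in lborel. norm (exponential_density 1 s * f (t - a * s))
      \<le> norm (exponential_density 1 s * C)"
    using bnd by (auto simp: abs_mult exponential_density_nonneg
        intro!: mult_left_mono)
qed simp

lemma exp_mean_0: "exp_mean 0 f t = f t"
  by (simp add: exp_mean_def integral_exponential_density)

lemma exp_mean_bounded:
  assumes "f \<in> borel_measurable borel" and bnd: "\<And>x. \<bar>f x\<bar> \<le> C"
  shows "\<bar>exp_mean a f t\<bar> \<le> C"
proof -
  have "norm (exp_mean a f t) \<le> (LINT s|lborel. norm (exponential_density 1 s * f (t - a * s)))"
    unfolding exp_mean_def by (rule integral_norm_bound)
  also have "\<dots> \<le> (LINT s|lborel. exponential_density 1 s * C)"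
    using bnd by (intro integral_mono integrable_norm integrable_exp_mean[OF assms]
        integrable_mult_left integrable_exponential_density)
      (auto simp: abs_mult exponential_density_nonneg intro!: mult_left_mono)
  finally show ?thesis
    by (simp add: integral_exponential_density)
qed

text \<open>Splitting off the integral over \<open>{..h - 1}\<close>, which does not depend on
  \<open>u\<close>, leaves an integral over a compact interval, and there the fundamental theorem of
  calculus applies.\<close>

lemma has_real_derivative_LBINT_atMost:
  fixes q :: "real \<Rightarrow> real"
  assumes cont: "continuous_on UNIV q" and int: "\<And>u. set_integrable lborel {..u} q"
  shows "((\<lambda>u. LBINT x:{..u}. q x) has_real_derivative q h) (at h)"
proof -
  have eq: "(LBINT x:{..u}. q x) = (LBINT x:{..h - 1}. q x) + integral {h - 1..u} q"
    if "u \<in> {h - 1<..<h + 1}" for u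
  proof -
    have i: "set_integrable lborel {h - 1..u} q"
      by (rule set_integrable_subset[OF int[of u]]) auto
    have i': "set_integrable lborel {h - 1<..u} q"
      by (rule set_integrable_subset[OF int[of u]]) auto
    have "{..u} = {..h - 1} \<union> {h - 1<..u}"
      using that by auto
    then have "(LBINT x:{..u}. q x) = (LBINT x:{..h - 1}. q x) + (LBINT x:{h - 1<..u}. q x)"
      using set_integral_Un[OF _ int[of "h - 1"] i'] by force
    also have "(LBINT x:{h - 1<..u}. q x) = (LBINT x:{h - 1..u}. q x)"
      by (rule set_integral_discrete_difference[where X="{h - 1}"]) auto
    also have "\<dots> = integral {h - 1..u} q"
      by (rule set_borel_integral_eq_integral(2)[OF i])
    finally show ?thesis .
  qed
  have "((\<lambda>u. integral {h - 1..u} q) has_real_derivative q h) (at h within {h - 1..h + 1})"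
    by (rule integral_has_real_derivative) (auto intro: continuous_on_subset[OF cont])
  then have "((\<lambda>u. integral {h - 1..u} q) has_real_derivative q h) (at h)"
    by (simp add: at_within_Icc_at)
  then have "((\<lambda>u. (LBINT x:{..h - 1}. q x) + integral {h - 1..u} q) has_real_derivative q h) (at h)"
    by (auto intro!: derivative_eq_intros)
  then show ?thesis
    by (rule has_field_derivative_transform_within_open[of _ _ _ "{h - 1<..<h + 1}"])
      (auto simp: eq)
qed

text \<open>The substitution \<open>x = t / a - s\<close> turns the mean into
  \<open>exp (- t / a)\<close> times the integral of \<open>exp x * f (a * x)\<close> over
  \<open>x\<close> up to \<open>t / a\<close>. The product rule then gives the linear equation.
  Working with \<open>h = t / a\<close> covers both signs of \<open>a\<close> at once.\<close>

lemma exp_mean_has_real_derivative: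
  fixes f :: "real \<Rightarrow> real"
  assumes a: "a \<noteq> 0" and cont: "continuous_on UNIV f" and bnd: "\<And>x. \<bar>f x\<bar> \<le> C"
  shows "(exp_mean a f has_real_derivative (f t - exp_mean a f t) / a) (at t)"
proof -
  define q where "q = (\<lambda>x. exp x * f (a * x))"
  have [measurable]: "f \<in> borel_measurable borel"
    using cont by (rule borel_measurable_continuous_onI)
  have reflect: "exponential_density 1 (h - x) * f (a * h - a * (h - x))
      = exp (- h) * (indicator {..h} x * q x)" for h x
    by (auto simp: exponential_density_def q_def exp_diff exp_minus field_simps indicator_def)
  have int: "set_integrable lborel {..h} q" for h
  proof -
    have "integrable lborel (\<lambda>x. exponential_density 1 (h + (-1) * x) * f (a * h - a * (h + (-1) * x)))"
      by (rule lborel_integrable_real_affine[OF integrable_exp_mean[OF _ bnd]]) auto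
    then have "integrable lborel (\<lambda>x. exp (- h) * (indicator {..h} x * q x))"
      using reflect by simp
    then show ?thesis
      by (simp add: set_integrable_def)
  qed
  have E: "exp_mean a f (a * h) = exp (- h) * (LBINT x:{..h}. q x)" for h
    unfolding exp_mean_def
    by (subst lborel_integral_real_affine[where c="-1" and t=h])
      (simp_all add: reflect set_lebesgue_integral_def)
  have "((\<lambda>u. LBINT x:{..u}. q x) has_real_derivative q (t / a)) (at (t / a))"
    using int by (intro has_real_derivative_LBINT_atMost)
      (auto simp: q_def intro!: continuous_intros continuous_on_compose2[OF cont])
  then have "((\<lambda>u. LBINT x:{..u / a}. q x) has_real_derivative q (t / a) * (1 / a)) (at t)"
    by (rule DERIV_chain2) (use a in \<open>auto intro!: derivative_eq_intros\<close>)
  then have "((\<lambda>u. exp (- (u / a)) * (LBINT x:{..u / a}. q x)) has_real_derivative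
      - (exp (- (t / a)) / a) * (LBINT x:{..t / a}. q x) + q (t / a) * (1 / a) * exp (- (t / a))) (at t)"
    using a by (auto intro!: derivative_eq_intros)
  moreover have "(\<lambda>u. exp (- (u / a)) * (LBINT x:{..u / a}. q x)) = exp_mean a f"
    using E[of "_ / a"] a by (auto simp: fun_eq_iff)
  moreover have "- (exp (- (t / a)) / a) * (LBINT x:{..t / a}. q x) + q (t / a) * (1 / a) * exp (- (t / a))
      = (f t - exp_mean a f t) / a"
    using E[of "t / a"] a by (simp add: q_def exp_minus field_simps)
  ultimately show ?thesis
    by simp
qed

text \<open>Both functions solve the same linear equation, so their difference is a constant times
  \<open>exp (- t / a)\<close>, and boundedness kills the constant. Continuity of \<open>g\<close>
  bridges the finitely many points of \<open>K\<close>, which leaves room for kinks.\<close>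

lemma exp_mean_eqI:
  fixes f g :: "real \<Rightarrow> real"
  assumes a: "a \<noteq> 0" and cont: "continuous_on UNIV f" and bnd: "\<And>x. \<bar>f x\<bar> \<le> C"
    and contg: "continuous_on UNIV g" and bndg: "\<And>x. \<bar>g x\<bar> \<le> C"
    and K: "finite K"
    and deriv: "\<And>t. t \<notin> K \<Longrightarrow> (g has_real_derivative (f t - g t) / a) (at t)"
  shows "exp_mean a f = g"
proof -
  let ?D = "\<lambda>t. exp (t / a) * (g t - exp_mean a f t)"
  have [measurable]: "f \<in> borel_measurable borel"
    using cont by (rule borel_measurable_continuous_onI)
  note E = exp_mean_has_real_derivative[OF a cont bnd]
  have D0: "(?D has_real_derivative 0) (at t)" if "t \<notin> K" for t
    using a by (auto intro!: derivative_eq_intros deriv[OF that] E simp: field_simps)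
  have contE: "continuous_on UNIV (exp_mean a f)"
    using E by (auto intro!: continuous_at_imp_continuous_on intro: DERIV_isCont)
  have contD: "continuous_on UNIV ?D"
    using a by (intro continuous_intros contg contE) auto
  have const: "?D t = ?D 0" for t
  proof (rule has_derivative_zero_unique_strong_connected[of UNIV K ?D 0])
    show "(?D has_derivative (\<lambda>h. 0)) (at x within UNIV)" if "x \<in> UNIV - K" for x
      using D0[of x] that by (simp add: has_field_derivative_def lambda_zero)
  qed (use contD K in auto)
  have bndD: "\<bar>?D 0\<bar> \<le> exp (t / a) * (2 * C)" for t
  proof -
    have "\<bar>g t - exp_mean a f t\<bar> \<le> 2 * C"
      using bndg[of t] exp_mean_bounded[of f C a t] bnd by fastforce
    then have "\<bar>?D t\<bar> \<le> exp (t / a) * (2 * C)"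
      by (simp add: abs_mult)
    then show ?thesis
      using const[of t] by simp
  qed
  \<comment> \<open>The bound is taken at \<open>t = a * y\<close> with \<open>y\<close> tending to
    minus infinity, which is possible for either sign of \<open>a\<close>.\<close>
  have "\<bar>?D 0\<bar> \<le> 0"
  proof (rule tendsto_lowerbound)
    show "((\<lambda>y. exp y * (2 * C)) \<longlongrightarrow> 0) at_bot"
      by (rule tendsto_mult_left_zero) (rule exp_at_bot)
    show "\<forall>\<^sub>F y in at_bot. \<bar>?D 0\<bar> \<le> exp y * (2 * C)"
      using bndD[of "a * _"] a by (auto intro!: always_eventually)
  qed simp
  then have "?D t = 0" for t
    using const[of t] by simp
  then show ?thesis
    by (auto simp: fun_eq_iff)
qed

section \<open>Distribution functions of the perturbed variable and of the maximum\<close>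

text \<open>By independence the joint law is a product, so Fubini allows fixing the exponential
  variable at \<open>s\<close> first.\<close>

lemma (in prob_space) cdf_add_std_exponential:
  assumes xi: "std_exponential M \<xi>" and ind: "indep_var borel \<xi> borel Z"
  shows "cdf (distr M borel (\<lambda>\<omega>. Z \<omega> + a * \<xi> \<omega>)) t = exp_mean a (cdf (distr M borel Z)) t"
proof -
  have D: "distributed M lborel \<xi> (exponential_density 1)"
    using xi by (simp add: std_exponential_def)
  have rv [measurable]: "\<xi> \<in> borel_measurable M" "Z \<in> borel_measurable M"
    and joint: "distr M borel \<xi> \<Otimes>\<^sub>M distr M borel Z = distr M (borel \<Otimes>\<^sub>M borel) (\<lambda>\<omega>. (\<xi> \<omega>, Z \<omega>))"
    using ind by (auto simp: indep_var_distribution_eq)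
  interpret Z: real_distribution "distr M borel Z"
    by simp
  have mono: "mono (cdf (distr M borel Z))"
    by (auto intro: monoI Z.cdf_nondecreasing)
  have [measurable]: "cdf (distr M borel Z) \<in> borel_measurable borel"
    by (rule borel_measurable_mono[OF mono])
  have bnd: "\<bar>cdf (distr M borel Z) x\<bar> \<le> 1" for x
    using Z.cdf_nonneg[of x] Z.cdf_bounded_prob[of x] by simp
  let ?S = "{p :: real \<times> real. snd p + a * fst p \<le> t}"
  have S [measurable]: "?S \<in> sets (borel \<Otimes>\<^sub>M borel)"
  proof -
    have "{p \<in> space (borel \<Otimes>\<^sub>M borel). snd p + a * fst p \<le> t} \<in> sets (borel \<Otimes>\<^sub>M borel)"
      by measurable
    then show ?thesis
      by (simp add: space_pair_measure)
  qed
  have "emeasure (distr M borel (\<lambda>\<omega>. Z \<omega> + a * \<xi> \<omega>)) {..t}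
      = emeasure (distr M (borel \<Otimes>\<^sub>M borel) (\<lambda>\<omega>. (\<xi> \<omega>, Z \<omega>))) ?S"
    using S by (subst (1 2) emeasure_distr) (auto intro!: arg_cong[where f="emeasure M"])
  also have "\<dots> = (\<integral>\<^sup>+s. emeasure (distr M borel Z) (Pair s -` ?S) \<partial>distr M borel \<xi>)"
    unfolding joint[symmetric] using S by (subst Z.emeasure_pair_measure_alt) (auto cong: sets_pair_measure_cong)
  \<comment> \<open>The slice of \<open>?S\<close> at \<open>s\<close> is the half-line up to
    \<open>t - a * s\<close>.\<close>
  also have "\<dots> = (\<integral>\<^sup>+s. ennreal (cdf (distr M borel Z) (t - a * s)) \<partial>distr M borel \<xi>)"
    by (intro nn_integral_cong)
      (auto simp: cdf_def Z.emeasure_eq_measure intro!: arg_cong[where f="measure _"])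
  also have "distr M borel \<xi> = density lborel (exponential_density 1)"
    using distributed_distr_eq_density[OF D] by (metis distr_cong sets_lborel)
  also have "(\<integral>\<^sup>+s. ennreal (cdf (distr M borel Z) (t - a * s)) \<partial>density lborel (exponential_density 1))
      = (\<integral>\<^sup>+s. ennreal (exponential_density 1 s * cdf (distr M borel Z) (t - a * s)) \<partial>lborel)"
    by (subst nn_integral_density) (auto simp: ennreal_mult exponential_density_nonneg Z.cdf_nonneg)
  also have "\<dots> = ennreal (exp_mean a (cdf (distr M borel Z)) t)"
    unfolding exp_mean_def
    by (intro nn_integral_eq_integral integrable_exp_mean[OF _ bnd])
      (auto simp: exponential_density_nonneg Z.cdf_nonneg)
  finally have "emeasure (distr M borel (\<lambda>\<omega>. Z \<omega> + a * \<xi> \<omega>)) {..t}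
      = ennreal (exp_mean a (cdf (distr M borel Z)) t)" .
  moreover have "0 \<le> exp_mean a (cdf (distr M borel Z)) t"
    unfolding exp_mean_def
    by (intro Bochner_Integration.integral_nonneg mult_nonneg_nonneg)
      (auto simp: exponential_density_nonneg Z.cdf_nonneg)
  ultimately show ?thesis
    by (simp add: cdf_def measure_def)
qed

lemma (in prob_space) cdf_sample_max:
  assumes iid: "iid_copies M n Y X" and n: "n > 0" and X: "X \<in> borel_measurable M"
  shows "cdf (distr M borel (sample_max n Y)) t = cdf (distr M borel X) t ^ n"
    and "sample_max n Y \<in> borel_measurable M"
proof -
  have ind: "indep_vars (\<lambda>_. borel) Y {..<n}" and D: "\<And>i. i < n \<Longrightarrow> distr M borel (Y i) = distr M borel X"
    using iid by (auto simp: iid_copies_def)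
  have Y: "Y i \<in> borel_measurable M" if "i < n" for i
    using ind that by (auto simp: indep_vars_def)
  show rv: "sample_max n Y \<in> borel_measurable M"
    unfolding sample_max_def[abs_def] using Y by (intro borel_measurable_Max) auto
  have le_iff: "sample_max n Y \<omega> \<le> t \<longleftrightarrow> (\<forall>i<n. Y i \<omega> \<le> t)" for \<omega>
    using n by (subst sample_max_def, subst Max_le_iff) auto
  have "cdf (distr M borel (sample_max n Y)) t = prob (\<Inter>i\<in>{..<n}. Y i -` {..t} \<inter> space M)"
    using n rv unfolding cdf_def
    by (subst measure_distr) (auto intro!: arg_cong[where f=prob] simp: le_iff)
  also have "\<dots> = (\<Prod>i<n. prob (Y i -` {..t} \<inter> space M))"
    using n by (intro indep_varsD[OF ind]) auto
  also have "\<dots> = (\<Prod>i<n. cdf (distr M borel (Y i)) t)"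
    using Y by (intro prod.cong) (auto simp: cdf_def measure_distr)
  also have "\<dots> = cdf (distr M borel X) t ^ n"
    using D by simp
  finally show "cdf (distr M borel (sample_max n Y)) t = cdf (distr M borel X) t ^ n" .
qed

section \<open>Differentiating the inner function of a composition\<close>

text \<open>Compare the Caratheodory slopes of \<open>f\<close> and of the composition:
  \<open>q z * (z - x) = p (g z) * (g z - g x)\<close>, where \<open>p (g z)\<close> is nonzero near
  \<open>x\<close>. This is how a merely continuous distribution function is shown to be
  differentiable.\<close>

lemma DERIV_inner_of_DERIV_comp:
  fixes f g :: "real \<Rightarrow> real"
  assumes f: "DERIV f (g x) :> D" and D: "D \<noteq> 0" and g: "isCont g x"
    and fg: "DERIV (\<lambda>s. f (g s)) x :> E"
  shows "DERIV g x :> E / D"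
proof -
  obtain p where p: "\<And>z. f z - f (g x) = p z * (z - g x)" "isCont p (g x)" "p (g x) = D"
    using f unfolding CARAT_DERIV by blast
  obtain q where q: "\<And>z. f (g z) - f (g x) = q z * (z - x)" "isCont q x" "q x = E"
    using fg unfolding CARAT_DERIV by blast
  have pg: "isCont (\<lambda>z. p (g z)) x"
    using isCont_o2[OF g p(2)] .
  have "((\<lambda>z. q z / p (g z)) \<longlongrightarrow> E / D) (at x)"
    using q(2,3) pg p(3) D by (auto intro!: tendsto_divide simp: isCont_def)
  moreover have "\<forall>\<^sub>F z in at x. p (g z) \<noteq> 0"
    using pg p(3) D by (auto simp: isCont_def intro: tendsto_imp_eventually_ne)
  then have "\<forall>\<^sub>F z in at x. q z / p (g z) = (g z - g x) / (z - x)"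
    using eventually_neq_at_within[of x x UNIV]
  proof eventually_elim
    case (elim z)
    have "q z * (z - x) = p (g z) * (g z - g x)"
      using p(1)[of "g z"] q(1)[of z] by simp
    with elim show ?case
      by (simp add: field_simps)
  qed
  ultimately show ?thesis
    unfolding has_field_derivative_iff using tendsto_cong by force
qed

section \<open>Continuous distribution functions: quantiles and differential equation\<close>

context
  fixes F :: "real \<Rightarrow> real"
  assumes mono_F: "mono F" and cont_F: "continuous_on UNIV F"
    and bot_F: "(F \<longlongrightarrow> 0) at_bot" and top_F: "(F \<longlongrightarrow> 1) at_top"
begin

lemma cdf_value_obtain:
  assumes "0 < x" "x < 1"
  obtains t where "F t = x"
proof -
  have "\<forall>\<^sub>F t in at_bot. F t < x"
    using order_tendstoD(2)[OF bot_F assms(1)] .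
  then obtain l where l: "\<And>t. t \<le> l \<Longrightarrow> F t < x"
    by (auto simp: eventually_at_bot_linorder)
  have "\<forall>\<^sub>F t in at_top. F t > x"
    using order_tendstoD(1)[OF top_F assms(2)] .
  then obtain r where r: "\<And>t. t \<ge> r \<Longrightarrow> F t > x"
    by (auto simp: eventually_at_top_linorder)
  have "F l < x" "x < F r"
    using l r by auto
  then have "l \<le> r"
    using monoD[OF mono_F, of r l] by linarith
  then obtain t where "F t = x"
    using IVT'[of F l x r] \<open>F l < x\<close> \<open>x < F r\<close> continuous_on_subset[OF cont_F] by auto
  then show thesis ..
qed

text \<open>Both sides say that \<open>W + k\<close> inverts \<open>F\<close> between the levels 0
  and 1. Continuity of \<open>W\<close> is what excludes flat stretches of \<open>F\<close>, at
  which the quantile function would jump.\<close>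

lemma quantile_eq_iff:
  fixes W :: "real \<Rightarrow> real"
  assumes contW: "continuous_on {0<..<1} W"
  shows "(\<forall>x. 0 < x \<and> x < 1 \<longrightarrow> quantile F x = W x + k)
    \<longleftrightarrow> (\<forall>t. 0 < F t \<and> F t < 1 \<longrightarrow> W (F t) = t - k)" (is "?L \<longleftrightarrow> ?R")
proof
  assume R: ?R
  show ?L
  proof (intro allI impI)
    fix x :: real assume x: "0 < x \<and> x < 1"
    obtain t where t: "F t = x"
      using cdf_value_obtain[of x] x by blast
    \<comment> \<open>Level sets of \<open>F\<close> inside the unit interval are single points,
      because \<open>W (F t)\<close> determines \<open>t\<close>.\<close>
    have "s \<ge> t" if "F s \<ge> x" for s
    proof (rule ccontr)
      assume "\<not> s \<ge> t"
      then have "F s = x"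
        using monoD[OF mono_F, of s t] t that by auto
      then have "t - k = s - k"
        using R t x by metis
      then show False
        using \<open>\<not> s \<ge> t\<close> by simp
    qed
    then have "{s. F s \<ge> x} = {t..}"
      using t monoD[OF mono_F] by auto
    then have "quantile F x = t"
      by (simp add: quantile_def)
    then show "quantile F x = W x + k"
      using R[rule_format, of t] t x by simp
  qed
next
  assume L: ?L
  show ?R
  proof (intro allI impI)
    fix t assume t: "0 < F t \<and> F t < 1"
    have below: "s > t" if "F s \<ge> y" "y > F t" for s y
      using monoD[OF mono_F, of s t] that by (cases "s \<le> t") auto
    have bdd: "bdd_below {s. F s \<ge> y}" if "0 < y" for y
    proof -
      obtain l where "\<And>s. s \<le> l \<Longrightarrow> F s < y"
        using order_tendstoD(2)[OF bot_F \<open>0 < y\<close>] by (auto simp: eventually_at_bot_linorder)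
      then show ?thesis
        by (intro bdd_belowI[of _ l]) (meson linorder_not_le nle_le mem_Collect_eq)
    qed
    have "quantile F (F t) \<le> t"
      unfolding quantile_def using bdd[of "F t"] t by (intro cInf_lower) auto
    then have le: "W (F t) + k \<le> t"
      using L t by simp
    have ge: "W y + k \<ge> t" if y: "F t < y" "y < 1" for y
    proof -
      obtain s where "F s = y"
        using cdf_value_obtain[of y] y t by auto
      then have "t \<le> quantile F y"
        unfolding quantile_def using below[OF _ y(1)] by (intro cInf_greatest) (auto intro: less_imp_le)
      then show ?thesis
        using L y t by simp
    qed
    \<comment> \<open>The lower bound \<open>t\<close> is known only at levels \<open>y\<close>
      above \<open>F t\<close>; continuity of \<open>W\<close> carries it down to \<open>F t\<close>
      itself.\<close>
    have "((\<lambda>y. W y + k) \<longlongrightarrow> W (F t) + k) (at_right (F t))"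
    proof -
      have "isCont W (F t)"
        using contW t by (simp add: continuous_on_eq_continuous_at)
      then show ?thesis
        by (intro tendsto_intros) (simp add: isCont_def filterlim_at_split)
    qed
    moreover have "\<forall>\<^sub>F y in at_right (F t). W y + k \<ge> t"
      using t ge by (auto simp: eventually_at_right_field)
    ultimately have "W (F t) + k \<ge> t"
      by (intro tendsto_lowerbound) auto
    with le show "W (F t) = t - k"
      by simp
  qed
qed

text \<open>Separation of variables for \<open>F' = w(F)\<close>, with \<open>W\<close> an
  antiderivative of \<open>1 / w\<close>. From left to right, differentiability of \<open>F\<close>
  is a conclusion, drawn from that of the composition of \<open>W\<close> with
  \<open>F\<close>.\<close>

lemma comp_cdf_affine_iff:
  fixes W w :: "real \<Rightarrow> real"
  assumes W: "\<And>x. 0 < x \<Longrightarrow> x < 1 \<Longrightarrow> (W has_real_derivative 1 / w x) (at x)"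
    and w: "\<And>x. 0 < x \<Longrightarrow> x < 1 \<Longrightarrow> w x > 0"
  shows "(\<exists>k. \<forall>t. 0 < F t \<and> F t < 1 \<longrightarrow> W (F t) = t - k)
    \<longleftrightarrow> (\<forall>t. 0 < F t \<and> F t < 1 \<longrightarrow> (F has_real_derivative w (F t)) (at t))" (is "?L \<longleftrightarrow> ?R")
proof
  let ?S = "{t. 0 < F t \<and> F t < 1}"
  have isCont: "isCont F t" for t
    using cont_F by (simp add: continuous_on_eq_continuous_at)
  have S: "open ?S"
    by (intro open_Collect_conj open_Collect_less continuous_on_const cont_F)
  {
    assume ?L
    then obtain k where k: "\<And>t. t \<in> ?S \<Longrightarrow> W (F t) = t - k"
      by auto
    show ?R
    proof (intro allI impI)
      fix t assume t: "0 < F t \<and> F t < 1"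
      have "((\<lambda>s. s - k) has_real_derivative 1) (at t)"
        by (auto intro!: derivative_eq_intros)
      then have "((\<lambda>s. W (F s)) has_real_derivative 1) (at t)"
        by (rule has_field_derivative_transform_within_open[OF _ S]) (use t k in auto)
      then have "(F has_real_derivative 1 / (1 / w (F t))) (at t)"
        using t w[of "F t"] by (intro DERIV_inner_of_DERIV_comp[OF W _ isCont]) auto
      then show "(F has_real_derivative w (F t)) (at t)"
        by simp
    qed
  }
  {
    assume R: ?R
    have "\<exists>c. \<forall>t\<in>?S. W (F t) - t = c"
    proof (rule has_field_derivative_zero_constant)
      \<comment> \<open>Monotonicity of \<open>F\<close> makes the set an interval, so one constant
        serves throughout.\<close>
      show "convex ?S"
        unfolding is_interval_convex_1[symmetric] is_interval_1
        using monoD[OF mono_F] by (auto intro: less_le_trans le_less_trans)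
      fix t assume t: "t \<in> ?S"
      have "((\<lambda>s. W (F s)) has_real_derivative 1 / w (F t) * w (F t)) (at t)"
        using t R by (intro DERIV_chain2[OF W]) auto
      then have "((\<lambda>s. W (F s) - s) has_real_derivative 0) (at t)"
        using t w[of "F t"] by (auto intro!: derivative_eq_intros)
      then show "((\<lambda>s. W (F s) - s) has_real_derivative 0) (at t within ?S)"
        by (rule has_field_derivative_at_within)
    qed
    then obtain c where "\<And>t. t \<in> ?S \<Longrightarrow> W (F t) - t = c"
      by auto
    then show ?L
      by (intro exI[of _ "- c"]) (auto simp: algebra_simps)
  }
qed

text \<open>If the two means agree, their common value is \<open>phi (F t)\<close>, and dividing its
  derivative by the slope \<open>phi'\<close> yields the equation for \<open>F\<close>. Conversely,
  that equation makes \<open>phi (F t)\<close> a bounded solution of both linear equations off a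
  finite set, and \<open>exp_mean_eqI\<close> identifies it with both means.\<close>

lemma exp_mean_eq_iff:
  fixes a b :: real and n :: nat
  assumes a: "a \<ge> 0" and b: "b \<ge> 0" and ab: "(a, b) \<noteq> (0, 0)" and n: "n \<ge> 2"
  defines "G \<equiv> \<lambda>t. F t ^ n"
  shows "exp_mean a F = exp_mean (- b) G
    \<longleftrightarrow> (\<forall>t. 0 < F t \<and> F t < 1 \<longrightarrow>
          (F has_real_derivative (F t - F t ^ n) / (b + real n * a * F t ^ (n - 1))) (at t))"
    (is "?L \<longleftrightarrow> ?R")
proof
  have ab_pos: "a + b > 0"
    using a b ab by auto
  have F01: "0 \<le> F t" "F t \<le> 1" for t
  proof -
    show "0 \<le> F t"
      by (rule tendsto_upperbound[OF bot_F])
        (auto simp: eventually_at_bot_linorder intro!: exI[of _ t] monoD[OF mono_F])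
    show "F t \<le> 1"
      by (rule tendsto_lowerbound[OF top_F])
        (auto simp: eventually_at_top_linorder intro!: exI[of _ t] monoD[OF mono_F])
  qed
  then have bnd: "\<bar>F t\<bar> \<le> 1" "\<bar>G t\<bar> \<le> 1" for t
    by (auto simp: G_def power_le_one)
  have cont_G: "continuous_on UNIV G"
    unfolding G_def by (intro continuous_intros cont_F)
  have isCont: "isCont F t" for t
    using cont_F by (simp add: continuous_on_eq_continuous_at)
  \<comment> \<open>The weights \<open>b\<close> and \<open>a\<close> eliminate the derivative from
    \<open>H + a * H' = F\<close> and \<open>H - b * H' = G\<close>.\<close>
  define phi where "phi = (\<lambda>u. (b * u + a * u ^ n) / (a + b))"
  define phi' where "phi' = (\<lambda>u. (b + real n * a * u ^ (n - 1)) / (a + b))"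
  have phi: "(phi has_real_derivative phi' u) (at u)" for u
    unfolding phi_def phi'_def by (intro DERIV_cdivide) (auto intro!: derivative_eq_intros)
  \<comment> \<open>For \<open>b = 0\<close> the slope vanishes at \<open>u = 0\<close>, hence the
    restriction to positive \<open>u\<close>.\<close>
  have phi'_pos: "phi' u > 0" if "u > 0" for u
    using that a b ab n unfolding phi'_def
    by (intro divide_pos_pos ab_pos) (cases "b = 0"; auto intro!: add_pos_nonneg)
  have quot: "(F t - F t ^ n) / (a + b) / phi' (F t)
      = (F t - F t ^ n) / (b + real n * a * F t ^ (n - 1))" for t
    using ab_pos by (simp add: phi'_def)
  note EF = exp_mean_has_real_derivative[OF _ cont_F bnd(1), of a]
  note EG = exp_mean_has_real_derivative[OF _ cont_G bnd(2), of "- b"]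
  {
    assume L: ?L
    let ?H = "exp_mean a F"
    have H: "?H t = phi (F t) \<and> (?H has_real_derivative (F t - F t ^ n) / (a + b)) (at t)" for t
    proof -
      \<comment> \<open>If \<open>a\<close> or \<open>b\<close> is zero, one linear equation
        degenerates to \<open>H = F\<close> or \<open>H = G\<close> and only the other one is
        differential.\<close>
      consider "a = 0" "b > 0" | "a > 0" "b = 0" | "a > 0" "b > 0"
        using a b ab by fastforce
      then show ?thesis
      proof cases
        case 1
        then have "?H = F"
          by (simp add: fun_eq_iff exp_mean_0)
        moreover have "(G t - F t) / (- b) = (F t - F t ^ n) / b"
          using 1 by (simp add: G_def field_simps)
        ultimately show ?thesis
          using EG[of t] L 1 by (simp add: phi_def)
      next
        case 2
        then have "?H = G"
          using L by (simp add: fun_eq_iff exp_mean_0)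
        then show ?thesis
          using EF[of t] L 2 by (simp add: phi_def G_def)
      next
        case 3
        then have 1: "(?H has_real_derivative (F t - ?H t) / a) (at t)"
          using EF[of t] by simp
        have 2: "(?H has_real_derivative (G t - ?H t) / (- b)) (at t)"
          using EG[of t] 3 L by simp
        have "(F t - ?H t) / a = (G t - ?H t) / (- b)"
          using DERIV_unique[OF 1 2] .
        then have H: "?H t = phi (F t)"
          using 3 by (simp add: phi_def G_def field_simps)
        have "(F t - ?H t) / a = (F t - F t ^ n) / (a + b)"
          using 3 by (simp add: H phi_def divide_simps) (simp add: algebra_simps)
        then show ?thesis
          using H 1 by simp
      qed
    qed
    show ?R
    proof (intro allI impI)
      fix t assume t: "0 < F t \<and> F t < 1"
      have "(\<lambda>s. phi (F s)) = ?H"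
        using H by auto
      then have "((\<lambda>s. phi (F s)) has_real_derivative (F t - F t ^ n) / (a + b)) (at t)"
        using H[of t] by simp
      then have "(F has_real_derivative (F t - F t ^ n) / (a + b) / phi' (F t)) (at t)"
        using phi'_pos[of "F t"] t by (intro DERIV_inner_of_DERIV_comp[OF phi _ isCont]) auto
      then show "(F has_real_derivative (F t - F t ^ n) / (b + real n * a * F t ^ (n - 1))) (at t)"
        by (simp only: quot)
    qed
  }
  {
    assume R: ?R
    let ?P = "\<lambda>t. phi (F t)"
    \<comment> \<open>the possible endpoints of the interval where \<open>0 < F < 1\<close>, where \<open>F\<close> may have a kink\<close>
    define K where "K = {t. F t = 0 \<and> (\<forall>s>t. F s \<noteq> 0)} \<union> {t. F t = 1 \<and> (\<forall>s<t. F s \<noteq> 1)}"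
    have "finite K"
    proof -
      have subsingleton: "finite A" if "\<And>x y. x \<in> A \<Longrightarrow> y \<in> A \<Longrightarrow> \<not> x < y" for A :: "real set"
      proof (cases "A = {}")
        case False
        then obtain x where "x \<in> A"
          by auto
        have "A \<subseteq> {x}"
        proof
          fix y assume "y \<in> A"
          then have "\<not> x < y" "\<not> y < x"
            using that \<open>x \<in> A\<close> by blast+
          then show "y \<in> {x}"
            by simp
        qed
        then show ?thesis
          by (rule finite_subset) simp
      qed simp
      show ?thesis
        unfolding K_def by (intro finite_UnI subsingleton) auto
    qed
    have P: "(?P has_real_derivative (F t - F t ^ n) / (a + b)) (at t)" if t: "t \<notin> K" for t
    proof -
      consider "0 < F t" "F t < 1" | "F t = 0" | "F t = 1"
        using F01[of t] by linarith
      then show ?thesis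
      proof cases
        case 1
        have "(?P has_real_derivative phi' (F t) * ((F t - F t ^ n) / (a + b) / phi' (F t))) (at t)"
          using R[rule_format, of t] 1 unfolding quot by (intro DERIV_chain2[OF phi]) simp
        then show ?thesis
          using phi'_pos[OF 1(1)] by simp
      next
        \<comment> \<open>Since \<open>t\<close> is not in \<open>K\<close>, \<open>F\<close>
          vanishes up to some point beyond \<open>t\<close>, so \<open>phi (F t)\<close> is locally
          constant; both sides of the equation are zero. The level 1 is symmetric.\<close>
        case 2
        then obtain s where s: "s > t" "F s = 0"
          using t by (auto simp: K_def)
        have "((\<lambda>_. phi 0) has_real_derivative 0) (at t)"
          by simp
        then have "(?P has_real_derivative 0) (at t)"
        proof (rule has_field_derivative_transform_within_open[of _ _ _ "{..<s}"])
          fix r assume "r \<in> {..<s}"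
          then have "F r = 0"
            using monoD[OF mono_F, of r s] F01[of r] s by auto
          then show "phi 0 = phi (F r)"
            by simp
        qed (use s in auto)
        then show ?thesis
          using 2 n by (simp add: zero_power)
      next
        case 3
        then obtain s where s: "s < t" "F s = 1"
          using t by (auto simp: K_def)
        have "((\<lambda>_. phi 1) has_real_derivative 0) (at t)"
          by simp
        then have "(?P has_real_derivative 0) (at t)"
        proof (rule has_field_derivative_transform_within_open[of _ _ _ "{s<..}"])
          fix r assume "r \<in> {s<..}"
          then have "F r = 1"
            using monoD[OF mono_F, of s r] F01[of r] s by auto
          then show "phi 1 = phi (F r)"
            by simp
        qed (use s in auto)
        then show ?thesis
          using 3 n by simp
      qed
    qed
    have cont_P: "continuous_on UNIV ?P"
      unfolding phi_def using ab_pos by (intro continuous_intros cont_F) auto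
    have bnd_P: "\<bar>?P t\<bar> \<le> 1" for t
    proof -
      have "b * F t \<le> b * 1" "a * F t ^ n \<le> a * 1"
        using F01 a b by (intro mult_left_mono power_le_one; simp)+
      then show ?thesis
        using F01[of t] a b ab_pos by (simp add: phi_def field_simps)
    qed
    have "exp_mean a F = ?P"
    proof (cases "a = 0")
      case True
      then show ?thesis
        using ab_pos by (simp add: fun_eq_iff exp_mean_0 phi_def)
    next
      case False
      \<comment> \<open>The derivative found in \<open>P\<close> is rewritten as the right-hand side
        of the linear equation for \<open>a\<close>; the case of \<open>b\<close> below does the
        same for \<open>G\<close>.\<close>
      have "(F t - F t ^ n) / (a + b) = (F t - ?P t) / a" for t
        using False ab_pos by (simp add: phi_def divide_simps) (simp add: algebra_simps)
      then show ?thesis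
        using False cont_F bnd cont_P bnd_P \<open>finite K\<close> P by (intro exp_mean_eqI) auto
    qed
    moreover have "exp_mean (- b) G = ?P"
    proof (cases "b = 0")
      case True
      then show ?thesis
        using ab_pos by (simp add: fun_eq_iff exp_mean_0 phi_def G_def)
    next
      case False
      have "(F t - F t ^ n) / (a + b) = (G t - ?P t) / (- b)" for t
        using False ab_pos by (simp add: phi_def G_def divide_simps) (simp add: algebra_simps)
      then show ?thesis
        using False cont_G bnd cont_P bnd_P \<open>finite K\<close> P by (intro exp_mean_eqI) auto
    qed
    ultimately show ?L
      by simp
  }
qed

end

section \<open>The explicit antiderivative\<close>

text \<open>Partial fractions: \<open>1 / w\<close> equals \<open>b / x\<close> plus
  \<open>(b + n * a) * x ^ (n - 2) / (1 - x ^ (n - 1))\<close>. The value of \<open>d\<close> makes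
  the second term the derivative of \<open>- d * ln (1 - x ^ (n - 1))\<close>.\<close>

lemma DERIV_quantile_formula:
  fixes a b d x :: real and n :: nat
  assumes n: "n \<ge> 2" and d: "d = (b + real n * a) / (real n - 1)" and x: "0 < x" "x < 1"
    and ab: "a \<ge> 0" "b \<ge> 0" "(a, b) \<noteq> (0, 0)"
  shows "((\<lambda>x. b * ln x - d * ln (1 - x ^ (n - 1))) has_real_derivative
      1 / ((x - x ^ n) / (b + real n * a * x ^ (n - 1)))) (at x)"
proof -
  \<comment> \<open>This replaces the truncated differences \<open>n - 1\<close> and
    \<open>n - 2\<close> by \<open>m + 1\<close> and \<open>m\<close>.\<close>
  define m where "m = n - 2"
  have nm: "n = m + 2"
    using n by (simp add: m_def)
  have dm: "d * (real m + 1) = b + real n * a"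
  proof -
    have "d * (real n - 1) = b + real n * a"
      using d n by simp
    then show ?thesis
      by (simp add: nm add.commute)
  qed
  have pos: "1 - x ^ (m + 1) > 0"
    using x power_Suc_less_one[of x m] by simp
  have "((\<lambda>x. 1 - x ^ (m + 1)) has_real_derivative - ((real m + 1) * x ^ m)) (at x)"
    using DERIV_diff[OF DERIV_const DERIV_pow[of "m + 1" x]] by (simp add: add.commute)
  then have "((\<lambda>x. ln (1 - x ^ (m + 1))) has_real_derivative
      1 / (1 - x ^ (m + 1)) * - ((real m + 1) * x ^ m)) (at x)"
    by (rule DERIV_chain2[where g="\<lambda>x. 1 - x ^ (m + 1)", OF DERIV_ln_divide[OF pos]])
  from DERIV_diff[OF DERIV_cmult[OF DERIV_ln_divide[OF x(1)], of b] DERIV_cmult[OF this, of d]]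
  have "((\<lambda>x. b * ln x - d * ln (1 - x ^ (m + 1))) has_real_derivative
      b / x + d * (real m + 1) * x ^ m / (1 - x ^ (m + 1))) (at x)"
    by (simp add: algebra_simps add_divide_distrib)
  also have "b / x + d * (real m + 1) * x ^ m / (1 - x ^ (m + 1))
      = (b + real n * a * x ^ (m + 1)) / (x - x ^ (m + 2))"
  proof -
    have "x - x ^ (m + 2) = x * (1 - x ^ (m + 1))"
      by (simp add: algebra_simps)
    then show ?thesis
      unfolding dm using x pos by (simp add: divide_simps) (simp add: algebra_simps)
  qed
  finally show ?thesis
    by (simp add: nm)
qed

section \<open>From equality in law to the quantile formula\<close>

theorem mainTheorem4:
  fixes M :: "'a measure"
    and X \<xi>\<^sub>1 \<xi>\<^sub>2 :: "'a \<Rightarrow> real"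
    and Y :: "nat \<Rightarrow> 'a \<Rightarrow> real"
    and n :: nat
    and a b d :: real
  assumes "prob_space M"
    and "n \<ge> 2" and "a \<ge> 0" and "b \<ge> 0" and "(a, b) \<noteq> (0, 0)"
    and "X \<in> borel_measurable M"
    and "continuous_on UNIV (cdf (distr M borel X))"
    and "iid_copies M n Y X"
    and "std_exponential M \<xi>\<^sub>1" and "std_exponential M \<xi>\<^sub>2"
    and "prob_space.indep_var M borel \<xi>\<^sub>1 borel \<xi>\<^sub>2"
    and "prob_space.indep_var M borel \<xi>\<^sub>1 borel X"
    and "prob_space.indep_var M borel \<xi>\<^sub>2 borel (sample_max n Y)"
    and "d = (b + real n * a) / (real n - 1)"
  shows "distr M borel (\<lambda>\<omega>. X \<omega> + a * \<xi>\<^sub>1 \<omega>)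
           = distr M borel (\<lambda>\<omega>. sample_max n Y \<omega> - b * \<xi>\<^sub>2 \<omega>)
         \<longleftrightarrow>
         (\<exists>c>0. \<forall>x. 0 < x \<and> x < 1 \<longrightarrow>
            quantile (cdf (distr M borel X)) x
              = ln (c * x powr b * (1 - x ^ (n - 1)) powr (- d)))"
proof -
  interpret prob_space M
    by fact
  note [measurable] = \<open>X \<in> borel_measurable M\<close>
  interpret X: real_distribution "distr M borel X"
    by simp
  let ?F = "cdf (distr M borel X)"
  let ?W = "\<lambda>x. b * ln x - d * ln (1 - x ^ (n - 1))"
  let ?w = "\<lambda>x. (x - x ^ n) / (b + real n * a * x ^ (n - 1))"
  have [measurable]: "\<xi>\<^sub>1 \<in> borel_measurable M" "\<xi>\<^sub>2 \<in> borel_measurable M"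
    using assms(11) by (auto simp: indep_var_distribution_eq)
  have [measurable]: "sample_max n Y \<in> borel_measurable M"
    and max: "cdf (distr M borel (sample_max n Y)) = (\<lambda>t. ?F t ^ n)"
    using cdf_sample_max[OF assms(8)] assms(2) by auto
  have F: "mono ?F" "continuous_on UNIV ?F" "(?F \<longlongrightarrow> 0) at_bot" "(?F \<longlongrightarrow> 1) at_top"
    using assms(7) X.cdf_lim_at_bot X.cdf_lim_at_top_prob
    by (auto intro: monoI X.cdf_nondecreasing)
  have W: "(?W has_real_derivative 1 / ?w x) (at x)" if "0 < x" "x < 1" for x
    using DERIV_quantile_formula[OF assms(2,14) that assms(3-5)] .
  have w: "?w x > 0" if "0 < x" "x < 1" for x
  proof -
    have "x ^ n < x"
      using that assms(2) power_strict_decreasing[of 1 n x] by simp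
    moreover have "b + real n * a * x ^ (n - 1) > 0"
      using that assms(2-5) by (cases "b = 0") (auto intro!: add_pos_nonneg)
    ultimately show ?thesis
      by simp
  qed
  have cont_W: "continuous_on {0<..<1} ?W"
    by (intro continuous_at_imp_continuous_on ballI DERIV_isCont[OF W]) auto
  have ln_eq: "ln (c * x powr b * (1 - x ^ (n - 1)) powr (- d)) = ?W x + ln c"
    if "c > 0" "0 < x" "x < 1" for c x
  proof -
    have "1 - x ^ (n - 1) > 0"
      using that assms(2) by (simp add: power_less_one_iff)
    then show ?thesis
      using that by (simp add: ln_mult ln_powr)
  qed
  \<comment> \<open>Laws on the line are determined by their distribution functions. Subtraction is
    written as adding \<open>(- b)\<close> times the variable, so that the same convolution formula
    serves both sides.\<close>
  have "distr M borel (\<lambda>\<omega>. X \<omega> + a * \<xi>\<^sub>1 \<omega>) = distr M borel (\<lambda>\<omega>. sample_max n Y \<omega> - b * \<xi>\<^sub>2 \<omega>)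
      \<longleftrightarrow> cdf (distr M borel (\<lambda>\<omega>. X \<omega> + a * \<xi>\<^sub>1 \<omega>)) = cdf (distr M borel (\<lambda>\<omega>. sample_max n Y \<omega> + (- b) * \<xi>\<^sub>2 \<omega>))"
    by (auto intro!: cdf_unique)
  also have "\<dots> \<longleftrightarrow> exp_mean a ?F = exp_mean (- b) (\<lambda>t. ?F t ^ n)"
    using cdf_add_std_exponential[OF assms(9,12), of a] cdf_add_std_exponential[OF assms(10,13), of "- b"]
    unfolding max by (simp add: fun_eq_iff)
  also have "\<dots> \<longleftrightarrow> (\<forall>t. 0 < ?F t \<and> ?F t < 1 \<longrightarrow> (?F has_real_derivative ?w (?F t)) (at t))"
    using exp_mean_eq_iff[OF F assms(3-5,2)] .
  also have "\<dots> \<longleftrightarrow> (\<exists>k. \<forall>t. 0 < ?F t \<and> ?F t < 1 \<longrightarrow> ?W (?F t) = t - k)"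
    using comp_cdf_affine_iff[OF F, of ?W ?w] W w by blast
  also have "\<dots> \<longleftrightarrow> (\<exists>k. \<forall>x. 0 < x \<and> x < 1 \<longrightarrow> quantile ?F x = ?W x + k)"
    using quantile_eq_iff[OF F cont_W] by simp
  \<comment> \<open>The additive constant \<open>k\<close> corresponds to \<open>ln c\<close>, and
    \<open>exp\<close> maps the reals onto the positive reals.\<close>
  also have "\<dots> \<longleftrightarrow> (\<exists>c>0. \<forall>x. 0 < x \<and> x < 1 \<longrightarrow>
      quantile ?F x = ln (c * x powr b * (1 - x ^ (n - 1)) powr (- d)))" (is "?L \<longleftrightarrow> ?R")
  proof
    assume ?L
    then obtain k where "\<forall>x. 0 < x \<and> x < 1 \<longrightarrow> quantile ?F x = ?W x + k" ..
    then show ?R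
      by (intro exI[of _ "exp k"]) (simp add: ln_eq del: One_nat_def)
  next
    assume ?R
    then obtain c where "c > 0" "\<forall>x. 0 < x \<and> x < 1 \<longrightarrow>
      quantile ?F x = ln (c * x powr b * (1 - x ^ (n - 1)) powr (- d))"
      by blast
    then show ?L
      by (intro exI[of _ "ln c"]) (simp add: ln_eq del: One_nat_def)
  qed
  finally show ?thesis .
qed

end
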